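(* Let $a,b$ be nonzero real numbers, let $(\mathcal{F}_n(a,b))$ be the bi-periodic Fibonacci matrix sequence and $(\mathcal{L}_n(a,b))$ the bi-periodic Lucas matrix sequence. Then for all $m,n\in\mathbb{N}$: (i) $\displaystyle \mathcal{F}_m(a,b)\mathcal{F}_n(a,b)=\mathcal{F}_n(a,b)\mathcal{F}_m(a,b)=\left(\frac{b}{a}\right)^{\varepsilon(mn)}\mathcal{F}_{m+n}(a,b)$; (ii) $\displaystyle \mathcal{F}_m(a,b)\mathcal{L}_n(a,b)=\mathcal{L}_n(a,b)\mathcal{F}_m(a,b)=\left(\frac{b}{a}\right)^{\varepsilon(m)\varepsilon(n+1)}\mathcal{L}_{m+n}(a,b)$; (iii) $\displaystyle \mathcal{L}_m(a,b)\mathcal{L}_n(a,b)=\mathcal{L}_n(a,b)\mathcal{L}_m(a,b)=\left(\frac{a}{b}\right)^{2-\varepsilon(m+1)\varepsilon(n+1)}(ab+4)\,\mathcal{F}_{m+n}(a,b)$.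
   Context: Let $a,b$ be nonzero real numbers and $\mathbb{N}=\{0,1,2,\dots\}$. Put $\varepsilon(n)=1$ if $n$ is odd and $\varepsilon(n)=0$ if $n$ is even. The bi-periodic Fibonacci numbers are defined by $q_0=0$, $q_1=1$, and $q_n=a\,q_{n-1}+q_{n-2}$ if $n$ is even, $q_n=b\,q_{n-1}+q_{n-2}$ if $n$ is odd; the recurrence at $n=1$ gives $q_{-1}=1$. The bi-periodic Fibonacci matrix sequence is, for $n\ge0$, $$\mathcal{F}_n(a,b)=\begin{pmatrix} \left(\frac{b}{a}\right)^{\varepsilon(n)} q_{n+1} & \frac{b}{a}\,q_n\\ q_n & \left(\frac{b}{a}\right)^{\varepsilon(n)} q_{n-1}\end{pmatrix}.$$ The bi-periodic Lucas matrix sequence is defined by $$\mathcal{L}_0(a,b)=\begin{pmatrix} a & 2\\ 2\frac{a}{b} & -a\end{pmatrix},\qquad \mathcal{L}_1(a,b)=\begin{pmatrix} a^2+2\frac{a}{b} & a\\ \frac{a^2}{b} & 2\frac{a}{b}\end{pmatrix},$$ and for $n\ge 2$, $\mathcal{L}_n(a,b)=a\,\mathcal{L}_{n-1}(a,b)+\mathcal{L}_{n-2}(a,b)$ if $n$ is odd, $\mathcal{L}_n(a,b)=b\,\mathcal{L}_{n-1}(a,b)+\mathcal{L}_{n-2}(a,b)$ if $n$ is even. *)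

theory Defs
  imports "HOL-Analysis.Analysis"
begin

definition par :: "nat \<Rightarrow> nat" where
  "par n = (if odd n then 1 else 0)"

fun bifib :: "real \<Rightarrow> real \<Rightarrow> nat \<Rightarrow> real" where
  "bifib a b 0 = 0"
| "bifib a b (Suc 0) = 1"
| "bifib a b (Suc (Suc n)) =
     (if even (Suc (Suc n)) then a else b) * bifib a b (Suc n) + bifib a b n"

text \<open>\<open>bifib_pred a b n\<close> is \<open>q\<close> at index \<open>n - 1\<close>, where for \<open>n = 0\<close> the value
  \<open>1\<close> at index \<open>-1\<close> is the one forced by extending the recurrence to index 1.\<close>

fun bifib_pred :: "real \<Rightarrow> real \<Rightarrow> nat \<Rightarrow> real" where
  "bifib_pred a b 0 = 1"
| "bifib_pred a b (Suc n) = bifib a b n"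

lemma bifib_recurrence_1: "bifib a b 1 = b * bifib a b 0 + bifib_pred a b 0"
  by simp

definition fib_matrix :: "real \<Rightarrow> real \<Rightarrow> nat \<Rightarrow> real^2^2" where
  "fib_matrix a b n = vector
     [vector [(b / a) ^ par n * bifib a b (n + 1), (b / a) * bifib a b n],
      vector [bifib a b n, (b / a) ^ par n * bifib_pred a b n]]"

fun lucas_matrix :: "real \<Rightarrow> real \<Rightarrow> nat \<Rightarrow> real^2^2" where
  "lucas_matrix a b 0 = vector
     [vector [a, 2],
      vector [2 * (a / b), - a]]"
| "lucas_matrix a b (Suc 0) = vector
     [vector [a\<^sup>2 + 2 * (a / b), a],
      vector [a\<^sup>2 / b, 2 * (a / b)]]"
| "lucas_matrix a b (Suc (Suc n)) =
     (if odd (Suc (Suc n)) then a else b) *\<^sub>R lucas_matrix a b (Suc n) + lucas_matrix a b n"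

end

theory Submission imports Defs begin

text \<open>Both sequences are governed by \<open>F\<^sub>1\<close> and \<open>L\<^sub>0\<close>: up to powers of \<open>b/a\<close>, \<open>F\<^sub>n\<close> is \<open>F\<^sub>1\<^sup>n\<close>
  and \<open>L\<^sub>n\<close> is \<open>L\<^sub>0 F\<^sub>n\<close>.  Since \<open>L\<^sub>0\<close> commutes with \<open>F\<^sub>1\<close> and \<open>L\<^sub>0\<^sup>2 = (a/b)(ab+4) I\<close>, every product
  reduces to \<open>F\<^sub>m F\<^sub>n\<close>, and only the exponent of \<open>b/a\<close> has to be tracked by parity.\<close>

lemmas matrix_2_entries = vec_eq_iff forall_2 sum_2 matrix_matrix_mult_def

lemma par_even [simp]: "even n \<Longrightarrow> par n = 0"
  and par_odd [simp]: "odd n \<Longrightarrow> par n = 1"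
  by (simp_all add: par_def)

lemma matrix_add_rdistrib:
  fixes A B :: "'a::semiring_1 ^ 'n ^ 'm" and C :: "'a ^ 'k ^ 'n"
  shows "(A + B) ** C = A ** C + B ** C"
  by (simp add: matrix_matrix_mult_def vec_eq_iff sum.distrib distrib_right)

lemma fib_matrix_0: "fib_matrix a b 0 = mat 1"
  by (simp add: fib_matrix_def matrix_2_entries mat_def)

text \<open>The diagonal is shifted by one index, where \<open>bifib\<close> uses the other
  coefficient; the factor \<open>(b / a) ^ par n\<close> converts \<open>a\<close> into
  \<open>b\<close> there, so all entries share one recurrence.\<close>

lemma fib_matrix_Suc_Suc:
  assumes "a \<noteq> 0" "b \<noteq> 0"
  shows "fib_matrix a b (Suc (Suc n)) =
    (if even n then a else b) *\<^sub>R fib_matrix a b (Suc n) + fib_matrix a b n"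
  using assms
  by (cases n; cases "even n") (auto simp: fib_matrix_def matrix_2_entries field_simps)

text \<open>The rows of \<open>fib_matrix a b 1\<close> are \<open>b, b / a\<close> and
  \<open>1, 0\<close>, so multiplying by it performs one step of the recurrence.\<close>

lemma fib_matrix_1_mult:
  assumes "a \<noteq> 0" "b \<noteq> 0"
  shows "fib_matrix a b 1 ** fib_matrix a b n = (b / a) ^ par n *\<^sub>R fib_matrix a b (Suc n)"
  using assms
  by (cases n; cases "even n") (auto simp: fib_matrix_def matrix_2_entries field_simps)

text \<open>Both sides obey a second-order recurrence in \<open>m\<close>. For odd \<open>n\<close>
  the coefficients at \<open>m\<close> and \<open>m + n\<close> differ, and the power of
  \<open>b / a\<close> absorbs this.\<close>

lemma fib_matrix_mult:
  assumes "a \<noteq> 0" "b \<noteq> 0"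
  shows "fib_matrix a b m ** fib_matrix a b n = (b / a) ^ par (m * n) *\<^sub>R fib_matrix a b (m + n)"
proof (induction m rule: induct_nat_012)
  case 0
  show ?case by (simp add: fib_matrix_0)
next
  case 1
  show ?case using fib_matrix_1_mult[OF assms, of n] by simp
next
  case (ge2 m)
  then show ?case using assms
    by (cases "even m"; cases "even n")
      (simp_all add: fib_matrix_Suc_Suc matrix_add_rdistrib scaleR_add_right
        flip: scalar_matrix_assoc)
qed

lemma lucas_matrix_0_commute:
  assumes "a \<noteq> 0" "b \<noteq> 0"
  shows "lucas_matrix a b 0 ** fib_matrix a b n = fib_matrix a b n ** lucas_matrix a b 0"
proof (induction n rule: induct_nat_012)
  case 0
  show ?case by (simp add: fib_matrix_0)
next
  case 1
  show ?case using assms by (simp add: fib_matrix_def matrix_2_entries field_simps)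
next
  case (ge2 n)
  then show ?case using assms
    by (simp add: fib_matrix_Suc_Suc matrix_add_rdistrib matrix_add_ldistrib matrix_scalar_ac
        flip: scalar_matrix_assoc)
qed

text \<open>The Lucas recurrence is the Fibonacci one with \<open>a\<close> and \<open>b\<close>
  exchanged; the factor \<open>(a / b) ^ par n\<close> makes this exchange.\<close>

lemma lucas_matrix_eq:
  assumes "a \<noteq> 0" "b \<noteq> 0"
  shows "lucas_matrix a b n = (a / b) ^ par n *\<^sub>R (lucas_matrix a b 0 ** fib_matrix a b n)"
proof (induction n rule: induct_nat_012)
  case 0
  show ?case by (simp add: fib_matrix_0)
next
  case 1
  show ?case using assms
    by (simp add: fib_matrix_def matrix_2_entries field_simps power2_eq_square)
next
  case (ge2 n)
  then show ?case using assms
    by (cases "even n")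
      (simp_all add: fib_matrix_Suc_Suc matrix_add_ldistrib matrix_scalar_ac scaleR_add_right
        flip: scalar_matrix_assoc del: lucas_matrix.simps(1,2))
qed

text \<open>Cayley-Hamilton for a matrix of trace 0: the scalar is minus the determinant.\<close>

lemma lucas_matrix_0_square:
  assumes "a \<noteq> 0" "b \<noteq> 0"
  shows "lucas_matrix a b 0 ** lucas_matrix a b 0 = ((a / b) * (a * b + 4)) *\<^sub>R mat 1"
  using assms by (simp add: matrix_2_entries mat_def field_simps power2_eq_square)

lemma fib_lucas_matrix_mult:
  assumes "a \<noteq> 0" "b \<noteq> 0"
  shows "fib_matrix a b m ** lucas_matrix a b n =
      (b / a) ^ (par m * par (n + 1)) *\<^sub>R lucas_matrix a b (m + n)" (is ?fl)
    and "lucas_matrix a b n ** fib_matrix a b m =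
      (b / a) ^ (par m * par (n + 1)) *\<^sub>R lucas_matrix a b (m + n)" (is ?lf)
proof -
  let ?F = "fib_matrix a b" and ?L = "lucas_matrix a b"
  \<comment> \<open>On the left, the scalars released by \<open>?L n\<close> and by
    \<open>?F n ** ?F m\<close>; on the right, the claimed factor times the scalar of
    \<open>?L (m + n)\<close>.\<close>
  have scal: "(a / b) ^ par n * (b / a) ^ par (m * n) =
      (b / a) ^ (par m * par (n + 1)) * (a / b) ^ par (m + n)"
    using assms by (cases "even m"; cases "even n") simp_all
  have "?L n ** ?F m = (a / b) ^ par n *\<^sub>R (?L 0 ** (?F n ** ?F m))"
    by (subst lucas_matrix_eq[OF assms])
      (simp add: matrix_mul_assoc flip: scalar_matrix_assoc del: lucas_matrix.simps)
  also have "\<dots> = ((a / b) ^ par n * (b / a) ^ par (m * n)) *\<^sub>R (?L 0 ** ?F (m + n))"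
    by (simp add: fib_matrix_mult[OF assms] matrix_scalar_ac add.commute mult.commute
        flip: scalar_matrix_assoc del: lucas_matrix.simps)
  also have "\<dots> = (b / a) ^ (par m * par (n + 1)) *\<^sub>R ?L (m + n)"
    unfolding scal by (subst lucas_matrix_eq[OF assms, of "m + n"]) simp
  finally show ?lf .
  have "?F m ** ?L n = (a / b) ^ par n *\<^sub>R (?F m ** ?L 0 ** ?F n)"
    by (subst lucas_matrix_eq[OF assms])
      (simp add: matrix_mul_assoc matrix_scalar_ac flip: scalar_matrix_assoc
        del: lucas_matrix.simps)
  \<comment> \<open>\<open>?L 0\<close> moves past \<open>?F m\<close>; the two Fibonacci factors
    then swap because their product formula is symmetric.\<close>
  also have "?F m ** ?L 0 ** ?F n = ?L 0 ** (?F n ** ?F m)"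
    by (simp add: lucas_matrix_0_commute[OF assms, symmetric] fib_matrix_mult[OF assms]
        add.commute mult.commute flip: matrix_mul_assoc del: lucas_matrix.simps)
  also have "(a / b) ^ par n *\<^sub>R (?L 0 ** (?F n ** ?F m)) = ?L n ** ?F m"
    by (subst (2) lucas_matrix_eq[OF assms])
      (simp add: matrix_mul_assoc flip: scalar_matrix_assoc del: lucas_matrix.simps)
  finally show ?fl using \<open>?lf\<close> by simp
qed

lemma lucas_matrix_mult:
  assumes "a \<noteq> 0" "b \<noteq> 0"
  shows "lucas_matrix a b m ** lucas_matrix a b n =
    ((a / b) ^ (2 - par (m + 1) * par (n + 1)) * (a * b + 4)) *\<^sub>R fib_matrix a b (m + n)"
proof -
  let ?F = "fib_matrix a b" and ?L = "lucas_matrix a b"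
  let ?k = "(a / b) ^ par m * (b / a) ^ (par m * par (n + 1)) * (a / b) ^ par (m + n)"
  \<comment> \<open>\<open>?k\<close> is 1 if \<open>m\<close> and \<open>n\<close> are both even
    and \<open>a / b\<close> otherwise. The natural subtraction never truncates, since
    \<open>par\<close> is at most 1.\<close>
  have scal: "?k * ((a / b) * (a * b + 4)) = (a / b) ^ (2 - par (m + 1) * par (n + 1)) * (a * b + 4)"
    using assms by (cases "even m"; cases "even n") (simp_all add: power2_eq_square)
  have "?L m ** ?L n = (a / b) ^ par m *\<^sub>R (?L 0 ** (?F m ** ?L n))"
    by (subst lucas_matrix_eq[OF assms, of m])
      (simp add: matrix_mul_assoc flip: scalar_matrix_assoc del: lucas_matrix.simps)
  also have "\<dots> = ((a / b) ^ par m * (b / a) ^ (par m * par (n + 1))) *\<^sub>R (?L 0 ** ?L (m + n))"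
    by (simp add: fib_lucas_matrix_mult(1)[OF assms] matrix_scalar_ac
        flip: scalar_matrix_assoc del: lucas_matrix.simps)
  also have "\<dots> = ?k *\<^sub>R (?L 0 ** ?L 0 ** ?F (m + n))"
    by (subst lucas_matrix_eq[OF assms, of "m + n"])
      (simp add: matrix_mul_assoc matrix_scalar_ac flip: scalar_matrix_assoc
        del: lucas_matrix.simps)
  also have "\<dots> = (?k * ((a / b) * (a * b + 4))) *\<^sub>R ?F (m + n)"
    unfolding lucas_matrix_0_square[OF assms] by (simp flip: scalar_matrix_assoc)
  finally show ?thesis unfolding scal .
qed

theorem theorem3p2:
  fixes a b :: real and m n :: nat
  assumes "a \<noteq> 0" and "b \<noteq> 0"
  shows "(fib_matrix a b m ** fib_matrix a b n = fib_matrix a b n ** fib_matrix a b m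
          \<and> fib_matrix a b n ** fib_matrix a b m
            = (b / a) ^ par (m * n) *\<^sub>R fib_matrix a b (m + n))
       \<and> (fib_matrix a b m ** lucas_matrix a b n = lucas_matrix a b n ** fib_matrix a b m
          \<and> lucas_matrix a b n ** fib_matrix a b m
            = (b / a) ^ (par m * par (n + 1)) *\<^sub>R lucas_matrix a b (m + n))
       \<and> (lucas_matrix a b m ** lucas_matrix a b n = lucas_matrix a b n ** lucas_matrix a b m
          \<and> lucas_matrix a b n ** lucas_matrix a b m
            = ((a / b) ^ (2 - par (m + 1) * par (n + 1)) * (a * b + 4)) *\<^sub>R fib_matrix a b (m + n))"
  \<comment> \<open>Commutativity in (i) and (iii) follows from the symmetry of the right-hand sides
    in \<open>m\<close> and \<open>n\<close>.\<close>
  by (simp add: fib_matrix_mult[OF assms] fib_lucas_matrix_mult[OF assms]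
      lucas_matrix_mult[OF assms] add.commute[of n m] mult.commute[of n m]
      mult.commute[of "par (Suc n)" "par (Suc m)"])

end
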